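(* Let $\mathcal{A}\subset\mathbb{R}^t$ be a compact set, let $f:[0,\infty)\to[0,\infty]$ be lower semi-continuous, and let $K:\mathcal{A}\times\mathcal{A}\to[0,\infty]$ be given by $K(x,y)=f(|x-y|)$. Assume that: (A1) there is a $\mu\in\mathcal{M}(\mathcal{A})$ with $I[\mu]<\infty$; (A2) the kernel $K$ has a unique $K$-equilibrium measure, denoted $\mu_{\mathrm{eq}}$; (A3) the support of $\mu_{\mathrm{eq}}$ is all of $\mathcal{A}$; (A4) the potential $U^{e}(x):=\int_{\mathcal{A}}K(x,y)\,d\mu_{\mathrm{eq}}(y)$ is equal to a positive constant, denoted $W_K$, on all of $\mathcal{A}$. For each $N\geq 2$, choose some $\omega_N\in\mathcal{A}^N$ and let $\nu_N$ be the probability measure that assigns mass $N^{-1}$ to each point in $\omega_N$ (counting multiplicities). Then the following are equivalent: (1) The measures $\{\nu_N\}_{N\geq2}$ converge weakly to $\mu_{\mathrm{eq}}$ as $N\to\infty$. (2) $\displaystyle\lim_{N\to\infty}P(\omega_N)=W_K$. (3) $\displaystyle\lim_{N\to\infty}\left(\frac{1}{N}\sum_{y\in\omega_N}K(x,y)-P(\omega_N)\right)=0$ in $L^1(\mu_{\mathrm{eq}})$, as functions of $x\in\mathcal{A}$.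
   Context: $|\cdot|$ is the Euclidean norm on $\mathbb{R}^t$. $\mathcal{M}(\mathcal{A})$ is the set of (positive, Borel) probability measures with support in $\mathcal{A}$. For $\mu\in\mathcal{M}(\mathcal{A})$, its $K$-energy is $I[\mu]:=\int_{\mathcal{A}}\int_{\mathcal{A}}K(x,y)\,d\mu(x)\,d\mu(y)\in[0,\infty]$. A $K$-equilibrium measure is a measure $\mu\in\mathcal{M}(\mathcal{A})$ with $I[\mu]=\inf_{\nu\in\mathcal{M}(\mathcal{A})}I[\nu]$. An $N$-point configuration $\omega_N=(a_1,\ldots,a_N)\in\mathcal{A}^N$ consists of $N$ possibly non-distinct points of $\mathcal{A}$; sums over $y\in\omega_N$ count multiplicities, and $\nu_N=\frac1N\sum_{j=1}^N\delta_{a_j}$. The polarization of $\omega_N$ is $$P(\omega_N):=\min_{x\in\mathcal{A}}\frac{1}{N}\sum_{y\in\omega_N}K(x,y).$$ Weak convergence $\nu_N\to\mu$ means $\int g\,d\nu_N\to\int g\,d\mu$ for every continuous $g:\mathcal{A}\to\mathbb{R}$. *)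

theory Defs
  imports "HOL-Probability.Probability"
begin

definition lsc_on :: "'a::topological_space set \<Rightarrow> ('a \<Rightarrow> ennreal) \<Rightarrow> bool" where
  "lsc_on S f \<longleftrightarrow> (\<forall>x\<in>S. \<forall>c < f x. \<forall>\<^sub>F y in at x within S. c < f y)"

definition measure_support :: "'a::topological_space measure \<Rightarrow> 'a set" where
  "measure_support M = {x. \<forall>U. open U \<longrightarrow> x \<in> U \<longrightarrow> emeasure M U > 0}"

definition prob_measures_on :: "'a::euclidean_space set \<Rightarrow> 'a measure set" where
  "prob_measures_on A = {M. sets M = sets borel \<and> prob_space M \<and> measure_support M \<subseteq> A}"

definition potential ::
    "'a::euclidean_space set \<Rightarrow> ('a \<Rightarrow> 'a \<Rightarrow> ennreal) \<Rightarrow> 'a measure \<Rightarrow> 'a \<Rightarrow> ennreal" where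
  "potential A K \<mu> x = (\<integral>\<^sup>+y\<in>A. K x y \<partial>\<mu>)"

definition energy ::
    "'a::euclidean_space set \<Rightarrow> ('a \<Rightarrow> 'a \<Rightarrow> ennreal) \<Rightarrow> 'a measure \<Rightarrow> ennreal" where
  "energy A K \<mu> = (\<integral>\<^sup>+y\<in>A. (\<integral>\<^sup>+x\<in>A. K x y \<partial>\<mu>) \<partial>\<mu>)"

definition equilibrium_measure ::
    "'a::euclidean_space set \<Rightarrow> ('a \<Rightarrow> 'a \<Rightarrow> ennreal) \<Rightarrow> 'a measure \<Rightarrow> bool" where
  "equilibrium_measure A K \<mu> \<longleftrightarrow>
     \<mu> \<in> prob_measures_on A \<and> energy A K \<mu> = (INF \<nu>\<in>prob_measures_on A. energy A K \<nu>)"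

definition mean_potential ::
    "('a \<Rightarrow> 'a \<Rightarrow> ennreal) \<Rightarrow> nat \<Rightarrow> (nat \<Rightarrow> 'a) \<Rightarrow> 'a \<Rightarrow> ennreal" where
  "mean_potential K N a x = 1 / of_nat N * (\<Sum>j=1..N. K x (a j))"

text \<open>
  The polarization is a minimum over \<open>A\<close>. It is written as an infimum;
  \<open>polarization_attained\<close> below shows that the infimum is attained for the kernels
  under consideration.
\<close>

definition polarization ::
    "'a set \<Rightarrow> ('a \<Rightarrow> 'a \<Rightarrow> ennreal) \<Rightarrow> nat \<Rightarrow> (nat \<Rightarrow> 'a) \<Rightarrow> ennreal" where
  "polarization A K N a = (INF x\<in>A. mean_potential K N a x)"

text \<open>
  Pushing the uniform measure on the index set \<open>{1..N}\<close> forward along the configuration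
  counts repeated points with their multiplicity.
\<close>

definition empirical_measure :: "nat \<Rightarrow> (nat \<Rightarrow> 'a::euclidean_space) \<Rightarrow> 'a measure" where
  "empirical_measure N a = distr (uniform_count_measure {1..N}) borel a"

definition weakly_converges_on ::
    "'a::euclidean_space set \<Rightarrow> (nat \<Rightarrow> 'a measure) \<Rightarrow> 'a measure \<Rightarrow> bool" where
  "weakly_converges_on A \<nu> \<mu> \<longleftrightarrow>
     (\<forall>g::'a \<Rightarrow> real. continuous_on A g \<longrightarrow>
        (\<lambda>N. LINT x:A|\<nu> N. g x) \<longlonglongrightarrow> (LINT x:A|\<mu>. g x))"

lemma less_add_ennrealE:
  fixes c u v :: ennreal
  assumes "c < u + v" "0 < u" "0 < v"
  obtains a b where "a < u" "b < v" "c < a + b"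
proof -
  have cont: "x + d \<le> c" if "\<And>a. a < x \<Longrightarrow> a + d \<le> c" "0 < x" for x d :: ennreal
  proof (cases "d = \<infinity>")
    case True
    with that(1)[OF that(2)] show ?thesis by (auto simp: top_unique)
  next
    case False
    have "x \<le> c - d"
    proof (rule dense_le)
      fix a assume "a < x"
      with that(1) have "a + d \<le> c" by blast
      with False show "a \<le> c - d" using ennreal_minus_mono[of "a + d" c d d] by simp
    qed
    moreover have "d \<le> c" using that(1)[OF that(2)] by simp
    ultimately show ?thesis
      using add_right_mono[of x "c - d" d] by (simp add: diff_add_cancel_ennreal)
  qed
  have "\<exists>a b. a < u \<and> b < v \<and> c < a + b"
  proof (rule ccontr)
    assume "\<not> ?thesis"
    then have *: "a + b \<le> c" if "a < u" "b < v" for a b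
      using that by (auto simp: not_less[symmetric])
    have "v + u \<le> c"
    proof (rule cont[OF _ assms(3)])
      fix b assume "b < v"
      with * have "u + b \<le> c" by (intro cont[OF _ assms(2)])
      then show "b + u \<le> c" by (simp add: add.commute)
    qed
    with assms(1) show False by (simp add: add.commute)
  qed
  with that show thesis by blast
qed

lemma lsc_on_add:
  assumes "lsc_on S f" "lsc_on S g"
  shows "lsc_on S (\<lambda>x. f x + g x)"
  unfolding lsc_on_def
proof (intro ballI allI impI)
  fix x c assume x: "x \<in> S" and c: "c < f x + g x"
  have f: "\<forall>\<^sub>F y in at x within S. a < f y" if "a < f x" for a
    using assms(1) x that by (auto simp: lsc_on_def)
  have g: "\<forall>\<^sub>F y in at x within S. b < g y" if "b < g x" for b
    using assms(2) x that by (auto simp: lsc_on_def)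
  consider "f x = 0" | "g x = 0" | "0 < f x" "0 < g x"
    by (auto simp: zero_less_iff_neq_zero)
  then show "\<forall>\<^sub>F y in at x within S. c < f y + g y"
  proof cases
    case 1
    with c g[of c] show ?thesis by (auto elim!: eventually_mono intro: less_le_trans)
  next
    case 2
    with c f[of c] show ?thesis by (auto elim!: eventually_mono intro: less_le_trans)
  next
    case 3
    with c obtain a b where ab: "a < f x" "b < g x" "c < a + b"
      by (blast elim: less_add_ennrealE)
    from f[OF ab(1)] g[OF ab(2)] show ?thesis
    proof eventually_elim
      case (elim y)
      then have "a + b \<le> f y + g y" by (intro add_mono less_imp_le)
      with ab(3) show ?case by (rule less_le_trans)
    qed
  qed
qed

lemma lsc_on_sum:
  assumes "\<And>j. j \<in> J \<Longrightarrow> lsc_on S (f j)"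
  shows "lsc_on S (\<lambda>x. \<Sum>j\<in>J. f j x)"
  using assms
proof (induction J rule: infinite_finite_induct)
  case (insert j J)
  then show ?case by (simp add: lsc_on_add)
qed (auto simp: lsc_on_def)

lemma lsc_on_attains_inf:
  fixes h :: "'a::t2_space \<Rightarrow> ennreal"
  assumes "compact S" "S \<noteq> {}" "lsc_on S h"
  shows "\<exists>x\<in>S. h x = (INF y\<in>S. h y)"
proof (rule ccontr)
  assume neg: "\<not> ?thesis"
  define m where "m = (INF y\<in>S. h y)"
  have "\<exists>c U. m < c \<and> open U \<and> x \<in> U \<and> (\<forall>y\<in>U \<inter> S. c < h y)" if x: "x \<in> S" for x
  proof -
    have "m \<le> h x" unfolding m_def using x by (rule INF_lower)
    with neg x have "m < h x" by (force simp: m_def)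
    then obtain c where c: "m < c" "c < h x" using dense by blast
    with assms(3) x have "\<forall>\<^sub>F y in at x within S. c < h y" by (auto simp: lsc_on_def)
    then obtain U where "open U" "x \<in> U" "\<forall>y\<in>U. y \<noteq> x \<longrightarrow> y \<in> S \<longrightarrow> c < h y"
      unfolding eventually_at_topological by auto
    with c have "m < c \<and> open U \<and> x \<in> U \<and> (\<forall>y\<in>U \<inter> S. c < h y)" by auto
    then show ?thesis by (intro exI)
  qed
  then have "\<forall>x\<in>S. \<exists>p. m < fst p \<and> open (snd p) \<and> x \<in> snd p \<and> (\<forall>y\<in>snd p \<inter> S. fst p < h y)"
    by simp
  then obtain p where p: "\<forall>x\<in>S. m < fst (p x) \<and> open (snd (p x)) \<and> x \<in> snd (p x) \<and>
      (\<forall>y\<in>snd (p x) \<inter> S. fst (p x) < h y)"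
    by (rule bchoice[elim_format]) (elim exE)
  define c U where "c x = fst (p x)" and "U x = snd (p x)" for x
  have cU: "m < c x \<and> open (U x) \<and> x \<in> U x \<and> (\<forall>y\<in>U x \<inter> S. c x < h y)" if "x \<in> S" for x
    using p that by (simp add: c_def U_def)
  obtain T where T: "T \<subseteq> S" "finite T" "S \<subseteq> (\<Union>x\<in>T. U x)"
  proof (rule compactE_image[OF assms(1), of S U])
    show "open (U x)" if "x \<in> S" for x using cU[OF that] by simp
    show "S \<subseteq> (\<Union>x\<in>S. U x)" using cU by (intro subsetI UN_I) auto
  qed
  with assms(2) have "T \<noteq> {}" by auto
  have "Min (c ` T) \<le> m"
    unfolding m_def
  proof (rule INF_greatest)
    fix y assume "y \<in> S"
    with T obtain x where "x \<in> T" "y \<in> U x" by auto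
    with cU[of x] T \<open>y \<in> S\<close> have "c x \<le> h y" by (blast intro: less_imp_le)
    moreover have "Min (c ` T) \<le> c x" using \<open>x \<in> T\<close> T(2) by simp
    ultimately show "Min (c ` T) \<le> h y" by (rule order_trans[rotated])
  qed
  then obtain x where "x \<in> T" "c x \<le> m"
    using T(2) \<open>T \<noteq> {}\<close> by (auto simp: Min_le_iff)
  moreover have "m < c x" using cU[of x] T(1) \<open>x \<in> T\<close> by blast
  ultimately show False by simp
qed

lemma polarization_attained:
  fixes A :: "'a::euclidean_space set"
  assumes "compact A" "A \<noteq> {}" "lsc_on {0..} f"
    and K: "\<And>x y. x \<in> A \<Longrightarrow> y \<in> A \<Longrightarrow> K x y = f (norm (x - y))"
    and a: "a \<in> {1..N} \<rightarrow>\<^sub>E A"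
  shows "\<exists>x\<in>A. mean_potential K N a x = polarization A K N a"
proof -
  have kernel: "lsc_on A (\<lambda>x. K x y)" if y: "y \<in> A" for y
    unfolding lsc_on_def
  proof (intro ballI allI impI)
    fix x c assume x: "x \<in> A" and c: "c < K x y"
    with y have c': "c < f (norm (x - y))" by (simp add: K)
    have "\<forall>\<^sub>F r in at (norm (x - y)) within {0..}. c < f r"
      using assms(3) c' by (auto simp: lsc_on_def)
    then obtain U where U: "open U" "norm (x - y) \<in> U"
        "\<forall>r\<in>U. r \<noteq> norm (x - y) \<longrightarrow> r \<in> {0..} \<longrightarrow> c < f r"
      unfolding eventually_at_topological by auto
    have lim: "((\<lambda>z. norm (z - y)) \<longlongrightarrow> norm (x - y)) (at x within A)"
      by (intro tendsto_intros)
    have "\<forall>\<^sub>F z in at x within A. norm (z - y) \<in> U"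
      using topological_tendstoD[OF lim U(1,2)] .
    moreover have "\<forall>\<^sub>F z in at x within A. z \<in> A"
      by (simp add: eventually_at_filter)
    ultimately show "\<forall>\<^sub>F z in at x within A. c < K z y"
    proof eventually_elim
      case (elim z)
      with U(3) c' have "c < f (norm (z - y))"
        by (cases "norm (z - y) = norm (x - y)") auto
      with elim y show ?case by (simp add: K)
    qed
  qed
  obtain x where x: "x \<in> A"
      "(\<Sum>j=1..N. K x (a j)) = (INF z\<in>A. \<Sum>j=1..N. K z (a j))"
    using lsc_on_attains_inf[OF assms(1,2) lsc_on_sum[of "{1..N}" A "\<lambda>j x. K x (a j)"]]
      kernel a by (auto simp: PiE_iff)
  have "mean_potential K N a x = (INF z\<in>A. mean_potential K N a z)"
  proof (rule antisym)
    show "mean_potential K N a x \<le> (INF z\<in>A. mean_potential K N a z)"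
    proof (rule INF_greatest)
      fix z assume "z \<in> A"
      then have "(\<Sum>j=1..N. K x (a j)) \<le> (\<Sum>j=1..N. K z (a j))"
        unfolding x(2) by (rule INF_lower)
      then show "mean_potential K N a x \<le> mean_potential K N a z"
        unfolding mean_potential_def by (rule mult_left_mono) simp
    qed
  qed (rule INF_lower[OF x(1)])
  with x(1) show ?thesis by (auto simp: polarization_def)
qed

end

(*
  Symmetry of the kernel gives int U^(nu_N) d mu_eq = int U^(mu_eq) d nu_N = W, so P(omega_N) <= W
  and the L^1 norm in (3) equals W - P(omega_N): (2) and (3) say the same.

  K is an increasing limit of Lipschitz kernels, so if nu_N -> nu weakly and U^nu(x0) > c, then
  U^(nu_N) > c on a neighbourhood of x0 for all large N.  With nu = mu_eq and a finite subcover
  this gives (1) ==> (2).  For (2) ==> (1) take a weak limit nu of a subsequence: U^nu(x0) > W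
  would contradict the L^1 convergence, as mu_eq charges every neighbourhood of x0.  So U^nu <= W
  on A, the energy of nu is at most W, and nu = mu_eq by uniqueness.

  The weak limit comes from Helly selection on the real line, through a Borel injection of A into
  the reals whose inverse is uniformly continuous.
*)
theory Submission
  imports Defs
begin

section \<open>Probability measures on a closed set\<close>

text \<open>The complement of the support is the union of all open null sets. By Lindelof countably
  many of them already cover it, so it is null itself.\<close>

lemma emeasure_compl_measure_support:
  fixes M :: "'a::second_countable_topology measure"
  assumes "sets M = sets borel"
  shows "measure_support M \<in> sets M" "emeasure M (- measure_support M) = 0"
proof -
  define F where "F = {U. open U \<and> emeasure M U = 0}"
  have F: "- measure_support M = \<Union>F"
    by (auto simp: measure_support_def F_def zero_less_iff_neq_zero)
  obtain F' where F': "F' \<subseteq> F" "countable F'" "\<Union>F' = \<Union>F"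
    using Lindelof[of F] by (auto simp: F_def)
  have "\<Union>F' \<in> null_sets M"
    using F'(1,2) assms by (intro null_sets_UN'[of F' "\<lambda>U. U", simplified]) (auto simp: F_def null_sets_def)
  then show "emeasure M (- measure_support M) = 0"
    using F F'(3) by auto
  have "open (- measure_support M)"
    unfolding F by (auto simp: F_def)
  then show "measure_support M \<in> sets M"
    using assms by (simp add: open_closed)
qed

text \<open>Trades the topological support condition for an almost-everywhere one, the form that
  integrals and image measures work with. Closedness enters because \<open>-A\<close> is then an
  open null set, hence disjoint from the support.\<close>

lemma prob_measures_on_iff:
  assumes "closed A"
  shows "M \<in> prob_measures_on A \<longleftrightarrow> sets M = sets borel \<and> prob_space M \<and> (AE x in M. x \<in> A)"
proof (cases "sets M = sets borel")
  case True
  then have space: "space M = UNIV" using sets_eq_imp_space_eq by fastforce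
  have "measure_support M \<subseteq> A \<longleftrightarrow> (AE x in M. x \<in> A)"
  proof
    assume "measure_support M \<subseteq> A"
    then show "AE x in M. x \<in> A"
      using emeasure_compl_measure_support[OF True] True
      by (intro AE_I[of _ _ "- measure_support M"]) (auto simp: space)
  next
    assume *: "AE x in M. x \<in> A"
    have "emeasure M (-A) = 0"
      using assms True * AE_iff_measurable[of "-A" M "\<lambda>x. x \<in> A"] by (auto simp: space)
    then show "measure_support M \<subseteq> A"
      using assms unfolding measure_support_def open_closed
      by (metis (mono_tags, lifting) ComplI less_irrefl mem_Collect_eq double_complement subsetI)
  qed
  with True show ?thesis by (auto simp: prob_measures_on_def)
qed (auto simp: prob_measures_on_def)

lemma prob_measures_onD:
  assumes "closed A" "M \<in> prob_measures_on A"
  shows "sets M = sets borel" "prob_space M" "AE x in M. x \<in> A" "emeasure M A = 1"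
proof -
  show *: "sets M = sets borel" "prob_space M" "AE x in M. x \<in> A"
    using assms prob_measures_on_iff by auto
  have "A \<in> sets M" using assms(1) by (simp add: *)
  then show "emeasure M A = 1" using * prob_space.emeasure_eq_1_AE by metis
qed

lemma set_integrable_continuous_on:
  fixes g :: "'a::euclidean_space \<Rightarrow> real"
  assumes "compact A" "M \<in> prob_measures_on A" "continuous_on A g"
  shows "set_integrable M A g"
proof -
  note M = prob_measures_onD[OF compact_imp_closed[OF assms(1)] assms(2)]
  interpret prob_space M by fact
  obtain B where B: "\<And>x. x \<in> A \<Longrightarrow> norm (g x) \<le> B"
    using compact_imp_bounded[OF compact_continuous_image[OF assms(3,1)]]
    by (auto simp: bounded_iff)
  show ?thesis
    unfolding set_integrable_def
  proof (rule integrable_const_bound[where B=B])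
    show "AE x in M. norm (indicat_real A x *\<^sub>R g x) \<le> B"
      using M(3) by eventually_elim (use B in auto)
    show "(\<lambda>x. indicat_real A x *\<^sub>R g x) \<in> borel_measurable M"
      using borel_measurable_continuous_on_indicator[OF _ assms(3)] assms(1)
      by (simp add: measurable_cong_sets[OF M(1) refl] compact_imp_closed)
  qed
qed

lemma nn_integral_eq_set_integral:
  fixes g :: "'a::euclidean_space \<Rightarrow> real"
  assumes "compact A" "M \<in> prob_measures_on A" "continuous_on A g" "\<And>x. x \<in> A \<Longrightarrow> 0 \<le> g x"
  shows "(\<integral>\<^sup>+x\<in>A. ennreal (g x) \<partial>M) = ennreal (LINT x:A|M. g x)"
proof -
  have "(\<integral>\<^sup>+x\<in>A. ennreal (g x) \<partial>M) = (\<integral>\<^sup>+x. ennreal (indicat_real A x *\<^sub>R g x) \<partial>M)"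
    by (intro nn_integral_cong) (auto split: split_indicator)
  also have "\<dots> = ennreal (LINT x:A|M. g x)"
    unfolding set_lebesgue_integral_def
    using set_integrable_continuous_on[OF assms(1-3)] assms(4)
    by (intro nn_integral_eq_integral) (auto simp: set_integrable_def split: split_indicator)
  finally show ?thesis .
qed

section \<open>Lower semicontinuous functions\<close>

lemma lsc_on_compose:
  assumes "lsc_on T f" "continuous_on S h" "h ` S \<subseteq> T"
  shows "lsc_on S (\<lambda>x. f (h x))"
  unfolding lsc_on_def
proof (intro ballI allI impI)
  fix x c assume x: "x \<in> S" and c: "c < f (h x)"
  then obtain U where U: "open U" "h x \<in> U" "\<forall>r\<in>U. r \<noteq> h x \<longrightarrow> r \<in> T \<longrightarrow> c < f r"
    using assms(1,3) unfolding lsc_on_def eventually_at_topological by (metis image_subset_iff)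
  have "(h \<longlongrightarrow> h x) (at x within S)"
    using assms(2) x by (auto simp: continuous_on_def)
  from topological_tendstoD[OF this U(1,2)] have "\<forall>\<^sub>F z in at x within S. h z \<in> U" .
  moreover have "\<forall>\<^sub>F z in at x within S. z \<in> S"
    by (simp add: eventually_at_filter)
  ultimately show "\<forall>\<^sub>F z in at x within S. c < f (h z)"
  proof eventually_elim
    case (elim z)
    \<comment> \<open>The punctured filter in \<open>lsc_on\<close> says nothing at
      \<open>h x\<close> itself; there the bound is \<open>c\<close>.\<close>
    then show ?case using U(3) c assms(3) by (cases "h z = h x") auto
  qed
qed

lemma lsc_on_cong:
  assumes "lsc_on S f" "\<And>x. x \<in> S \<Longrightarrow> g x = f x"
  shows "lsc_on S g"
  unfolding lsc_on_def
proof (intro ballI allI impI)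
  fix x c assume "x \<in> S" "c < g x"
  with assms have "\<forall>\<^sub>F y in at x within S. c < f y" by (simp add: lsc_on_def)
  moreover have "\<forall>\<^sub>F y in at x within S. y \<in> S" by (simp add: eventually_at_filter)
  ultimately show "\<forall>\<^sub>F y in at x within S. c < g y" by eventually_elim (simp add: assms(2))
qed

text \<open>Inf-convolution (Pasch-Hausdorff envelope): \<open>F n x\<close> is the infimum over
  \<open>s\<close> in \<open>S\<close> of \<open>min (f s) n + n * dist x s\<close>. Truncation at
  \<open>n\<close> keeps it real valued where \<open>f\<close> is infinite, and an infimum of
  \<open>n\<close>-Lipschitz functions is \<open>n\<close>-Lipschitz on the whole space. Lower
  semicontinuity gives \<open>f\<close> \<le> the supremum.\<close>

lemma lsc_on_imp_SUP_lipschitz: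
  fixes f :: "'a::metric_space \<Rightarrow> ennreal"
  assumes f: "lsc_on S f" and "S \<noteq> {}"
  obtains F :: "nat \<Rightarrow> 'a \<Rightarrow> real" where
    "\<And>n x. 0 \<le> F n x" "\<And>x. incseq (\<lambda>n. F n x)"
    "\<And>n. (real n)-lipschitz_on UNIV (F n)"
    "\<And>x. x \<in> S \<Longrightarrow> f x = (SUP n. ennreal (F n x))"
proof -
  define G where "G n x s = enn2real (min (f s) (of_nat n)) + real n * dist x s" for n x s
  define F where "F n x = (INF s\<in>S. G n x s)" for n x
  have min_fin: "min (f s) (of_nat n) < top" for s n
    by (simp add: min_less_iff_disj of_nat_less_top)
  have G0: "0 \<le> G n x s" for n x s by (simp add: G_def)
  then have bdd: "bdd_below (G n x ` S)" for n x by (auto simp: bdd_below_def)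
  have lower: "F n x \<le> G n x s" if "s \<in> S" for n x s
    unfolding F_def using that by (intro cINF_lower bdd)
  have greatest: "b \<le> F n x" if "\<And>s. s \<in> S \<Longrightarrow> b \<le> G n x s" for b n x
    unfolding F_def using that assms(2) by (intro cINF_greatest) auto
  have Gmono: "G m x s \<le> G n x s" if "m \<le> n" for m n x s
    unfolding G_def using that min_fin
    by (intro add_mono enn2real_mono mult_right_mono min.mono) auto
  show ?thesis
  proof (rule that)
    show "0 \<le> F n x" for n x by (intro greatest G0)
    show "incseq (\<lambda>n. F n x)" for x
      by (intro incseq_SucI greatest order_trans[OF lower Gmono]) auto
    have step: "F n x - real n * dist x y \<le> F n y" for n x y
    proof (rule greatest)
      fix s assume "s \<in> S"
      have "real n * dist x s \<le> real n * dist x y + real n * dist y s"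
        by (simp flip: distrib_left add: mult_left_mono dist_triangle)
      with lower[OF \<open>s \<in> S\<close>, of n x] show "F n x - real n * dist x y \<le> G n y s"
        by (simp add: G_def)
    qed
    show "(real n)-lipschitz_on UNIV (F n)" for n
    proof (rule lipschitz_onI)
      show "dist (F n x) (F n y) \<le> real n * dist x y" for x y
        using step[of n x y] step[of n y x] unfolding dist_real_def dist_commute[of y x] by linarith
    qed simp
    fix x assume x: "x \<in> S"
    show "f x = (SUP n. ennreal (F n x))"
    proof (rule antisym)
      show "(SUP n. ennreal (F n x)) \<le> f x"
      proof (rule SUP_least)
        fix n
        have "ennreal (F n x) \<le> ennreal (G n x x)" using lower[OF x] by (intro ennreal_leI)
        also have "\<dots> = min (f x) (of_nat n)" by (simp add: G_def min_fin)
        finally show "ennreal (F n x) \<le> f x" by simp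
      qed
      show "f x \<le> (SUP n. ennreal (F n x))"
      proof (rule dense_le)
        fix c assume c: "c < f x"
        then obtain c' where c': "c = ennreal c'" "0 \<le> c'"
          by (cases c) (auto simp: less_top[symmetric])
        obtain d where d: "d > 0" "\<And>s. s \<in> S \<Longrightarrow> dist s x < d \<Longrightarrow> c < f s"
          using f x c unfolding lsc_on_def eventually_at by (metis dist_self)
        \<comment> \<open>\<open>c' \<le> n\<close> keeps the truncation from cutting below
          \<open>c'\<close> near \<open>x\<close>; \<open>c' / d \<le> n\<close> makes the distance
          term alone reach \<open>c'\<close> outside the \<open>d\<close>-ball.\<close>
        obtain n where n: "max c' (c' / d) \<le> real n" using real_arch_simple by blast
        have "c' \<le> F n x"
        proof (rule greatest)
          fix s assume s: "s \<in> S"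
          show "c' \<le> G n x s"
          proof (cases "dist s x < d")
            case True
            then have "ennreal c' \<le> min (f s) (of_nat n)"
              using d(2)[OF s] n c' by (auto simp: ennreal_of_nat_eq_real_of_nat intro!: ennreal_leI)
            then have "c' \<le> enn2real (min (f s) (of_nat n))"
              using c' min_fin enn2real_mono[of "ennreal c'"] by fastforce
            then show ?thesis by (simp add: G_def add_increasing2)
          next
            case False
            have "c' \<le> real n * d" using n d(1) by (simp add: field_simps)
            also have "\<dots> \<le> real n * dist x s"
              using False by (intro mult_left_mono) (auto simp: dist_commute)
            finally show ?thesis by (simp add: G_def add_increasing)
          qed
        qed
        then have "c \<le> ennreal (F n x)" using c' by (simp add: ennreal_leI)
        then show "c \<le> (SUP n. ennreal (F n x))" by (rule SUP_upper2[rotated]) simp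
      qed
    qed
  qed
qed

text \<open>On \<open>S\<close> the function is a countable supremum of continuous ones. The
  indicator removes the values off \<open>S\<close>, about which nothing is known.\<close>

lemma lsc_on_borel_measurable:
  fixes f :: "'a::metric_space \<Rightarrow> ennreal"
  assumes "lsc_on S f" "S \<in> sets borel"
  shows "(\<lambda>x. f x * indicator S x) \<in> borel_measurable borel"
proof (cases "S = {}")
  case False
  then obtain F :: "nat \<Rightarrow> 'a \<Rightarrow> real" where F: "\<And>n. (real n)-lipschitz_on UNIV (F n)"
    "\<And>x. x \<in> S \<Longrightarrow> f x = (SUP n. ennreal (F n x))"
    using lsc_on_imp_SUP_lipschitz[OF assms(1)] by metis
  note [measurable] = borel_measurable_continuous_onI[OF lipschitz_on_continuous_on[OF F(1)]] assms(2)
  have "(\<lambda>x. f x * indicator S x) = (\<lambda>x. (SUP n. ennreal (F n x)) * indicator S x)"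
    using F(2) by (auto split: split_indicator)
  then show ?thesis by simp
qed simp

lemma lsc_kernel_section:
  assumes "lsc_on (A \<times> A) (\<lambda>(x, y). K x y)" "x \<in> A"
  shows "lsc_on A (K x)"
proof -
  have "lsc_on A (\<lambda>y. case (x, y) of (x, y) \<Rightarrow> K x y)"
    using assms(2) by (intro lsc_on_compose[OF assms(1)] continuous_intros) auto
  then show ?thesis by simp
qed

section \<open>Potentials along weakly convergent sequences\<close>

text \<open>A local, uniform form of the principle of descent.\<close>

lemma potential_eventually_gt_nearby:
  fixes A :: "'a::euclidean_space set"
  assumes A: "compact A" and K: "lsc_on (A \<times> A) (\<lambda>(x, y). K x y)"
    and M: "\<And>i. M i \<in> prob_measures_on A" and \<nu>: "\<nu> \<in> prob_measures_on A"
    and weak: "weakly_converges_on A M \<nu>"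
    and x0: "x0 \<in> A" and c: "c < potential A K \<nu> x0"
  obtains V where "open V" "x0 \<in> V"
    "\<forall>\<^sub>F i in sequentially. \<forall>x\<in>A \<inter> V. c < potential A K (M i) x"
proof -
  have "A \<times> A \<noteq> {}" using x0 by auto
  then obtain F :: "nat \<Rightarrow> 'a \<times> 'a \<Rightarrow> real" where F:
    "\<And>n p. 0 \<le> F n p" "\<And>p. incseq (\<lambda>n. F n p)" "\<And>n. (real n)-lipschitz_on UNIV (F n)"
    "\<And>p. p \<in> A \<times> A \<Longrightarrow> (case p of (x, y) \<Rightarrow> K x y) = (SUP n. ennreal (F n p))"
    using lsc_on_imp_SUP_lipschitz[OF K] by metis
  have FK: "K x y = (SUP n. ennreal (F n (x, y)))" if "x \<in> A" "y \<in> A" for x y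
    using F(4)[of "(x, y)"] that by simp
  have cont: "continuous_on S (\<lambda>y. F n (x, y))" for n x S
    by (rule continuous_on_compose2[OF lipschitz_on_continuous_on[OF F(3)]]) (auto intro!: continuous_intros)
  note [measurable] = borel_measurable_continuous_onI[OF cont]
  have [measurable]: "A \<in> sets borel" using A by (simp add: compact_imp_closed)
  note sets_\<nu> = prob_measures_onD(1)[OF compact_imp_closed[OF A] \<nu>]
  have "potential A K \<nu> x0 = (\<integral>\<^sup>+y. (SUP n. ennreal (F n (x0, y)) * indicator A y) \<partial>\<nu>)"
    unfolding potential_def using FK[OF x0]
    by (intro nn_integral_cong) (auto split: split_indicator)
  also have "\<dots> = (SUP n. \<integral>\<^sup>+y\<in>A. ennreal (F n (x0, y)) \<partial>\<nu>)"
  proof (rule nn_integral_monotone_convergence_SUP)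
    show "incseq (\<lambda>n y. ennreal (F n (x0, y)) * indicator A y)"
      using F(2) by (intro incseq_SucI le_funI mult_right_mono ennreal_leI) (auto simp: incseq_Suc_iff)
    show "(\<lambda>y. ennreal (F n (x0, y)) * indicator A y) \<in> borel_measurable \<nu>" for n
      unfolding measurable_cong_sets[OF sets_\<nu> refl] by measurable
  qed
  \<comment> \<open>By monotone convergence one Lipschitz level \<open>n\<close> already lifts the
    integral above \<open>c\<close>; it stays fixed from here on.\<close>
  finally obtain n where "c < (\<integral>\<^sup>+y\<in>A. ennreal (F n (x0, y)) \<partial>\<nu>)"
    using c by (auto simp: less_SUP_iff)
  then have n: "c < ennreal (LINT y:A|\<nu>. F n (x0, y))"
    by (simp add: nn_integral_eq_set_integral[OF A \<nu> cont] F(1))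
  then obtain c' where c': "c = ennreal c'" "0 \<le> c'" "c' < (LINT y:A|\<nu>. F n (x0, y))"
    by (cases c) (auto simp: ennreal_less_iff)
  \<comment> \<open>Half of the gap above \<open>c'\<close>: one \<open>e\<close> is spent on the
    weak convergence at \<open>x0\<close>, the other on moving from \<open>x0\<close> to a point of
    \<open>V\<close>.\<close>
  define e where "e = ((LINT y:A|\<nu>. F n (x0, y)) - c') / 2"
  have e: "e > 0" using c' by (simp add: e_def)
  have "(\<lambda>i. LINT y:A|M i. F n (x0, y)) \<longlonglongrightarrow> (LINT y:A|\<nu>. F n (x0, y))"
    using weak cont by (simp add: weakly_converges_on_def)
  then have ev: "\<forall>\<^sub>F i in sequentially. c' + e < (LINT y:A|M i. F n (x0, y))"
    by (rule order_tendstoD) (use e in \<open>simp add: e_def field_simps\<close>)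
  \<comment> \<open>The \<open>+ 1\<close> avoids a division by zero when
    \<open>n = 0\<close>.\<close>
  define V where "V = ball x0 (e / (real n + 1))"
  have "\<forall>\<^sub>F i in sequentially. \<forall>x\<in>A \<inter> V. c < potential A K (M i) x"
    using ev
  proof (eventually_elim, intro ballI)
    fix i x assume i: "c' + e < (LINT y:A|M i. F n (x0, y))" and x: "x \<in> A \<inter> V"
    note M_i = prob_measures_onD[OF compact_imp_closed[OF A] M[of i]]
    have "real n * dist x0 x \<le> real n * (e / (real n + 1))"
      using x by (intro mult_left_mono) (auto simp: V_def)
    also have "\<dots> \<le> e" using e by (simp add: field_simps)
    finally have d: "real n * dist x0 x \<le> e" .
    have "(LINT y:A|M i. F n (x0, y)) \<le> (LINT y:A|M i. F n (x, y) + e)"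
    proof (rule set_integral_mono)
      show "set_integrable (M i) A (\<lambda>y. F n (x0, y))" "set_integrable (M i) A (\<lambda>y. F n (x, y) + e)"
        by (intro set_integrable_continuous_on A M cont continuous_intros)+
      \<comment> \<open>The two points of the product differ only in the first coordinate, so the
        Lipschitz bound is the same for every \<open>y\<close>.\<close>
      show "F n (x0, y) \<le> F n (x, y) + e" for y
        using lipschitz_onD[OF F(3)[of n], of "(x0, y)" "(x, y)"] d
        by (simp add: dist_Pair_Pair dist_real_def)
    qed
    also have "\<dots> = (LINT y:A|M i. F n (x, y)) + (LINT y:A|M i. e)"
      using A M cont by (intro set_integral_add set_integrable_continuous_on) (auto intro!: continuous_intros)
    also have "(LINT y:A|M i. e) = e"
      using M_i(4) by (simp add: set_lebesgue_integral_def measure_def M_i(1))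
    finally have "c' < (LINT y:A|M i. F n (x, y))" using i by simp
    then have "c < ennreal (LINT y:A|M i. F n (x, y))"
      using c' by (simp add: ennreal_less_iff)
    also have "\<dots> = (\<integral>\<^sup>+y\<in>A. ennreal (F n (x, y)) \<partial>M i)"
      by (simp add: nn_integral_eq_set_integral[OF A M cont] F(1))
    also have "\<dots> \<le> potential A K (M i) x"
      unfolding potential_def using x FK
      by (intro nn_integral_mono) (auto split: split_indicator intro!: SUP_upper)
    finally show "c < potential A K (M i) x" .
  qed
  with that[of V] e show ?thesis by (auto simp: V_def)
qed

text \<open>Each point has a neighbourhood on which the bound eventually holds. Compactness leaves
  finitely many of them, so one threshold for \<open>i\<close> serves all of
  \<open>A\<close>.\<close>

lemma potential_eventually_gt:
  fixes A :: "'a::euclidean_space set"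
  assumes A: "compact A" and K: "lsc_on (A \<times> A) (\<lambda>(x, y). K x y)"
    and M: "\<And>i. M i \<in> prob_measures_on A" and \<nu>: "\<nu> \<in> prob_measures_on A"
    and weak: "weakly_converges_on A M \<nu>"
    and c: "\<And>x. x \<in> A \<Longrightarrow> c < potential A K \<nu> x"
  shows "\<forall>\<^sub>F i in sequentially. \<forall>x\<in>A. c < potential A K (M i) x"
proof -
  have "\<exists>V. open V \<and> x \<in> V \<and> (\<forall>\<^sub>F i in sequentially. \<forall>y\<in>A \<inter> V. c < potential A K (M i) y)"
    if "x \<in> A" for x
    using potential_eventually_gt_nearby[OF A K M \<nu> weak that c[OF that]] by metis
  then obtain V where V: "\<And>x. x \<in> A \<Longrightarrow> open (V x)" "\<And>x. x \<in> A \<Longrightarrow> x \<in> V x"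
    "\<And>x. x \<in> A \<Longrightarrow> \<forall>\<^sub>F i in sequentially. \<forall>y\<in>A \<inter> V x. c < potential A K (M i) y"
    by metis
  have "A \<subseteq> (\<Union>x\<in>A. V x)" using V(2) by auto
  then obtain T where T: "T \<subseteq> A" "finite T" "A \<subseteq> (\<Union>x\<in>T. V x)"
    using compactE_image[OF A, of A V] V(1) by metis
  have "\<forall>\<^sub>F i in sequentially. \<forall>x\<in>T. \<forall>y\<in>A \<inter> V x. c < potential A K (M i) y"
    using T V(3) by (intro eventually_ball_finite) auto
  then show ?thesis by eventually_elim (use T(3) in blast)
qed

text \<open>The reverse of the principle of descent: a limit potential exceeding \<open>W\<close> somewhere would
  force the approximating potentials to exceed \<open>W\<close> on an open set charged by \<open>\<mu>\<close>.\<close>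

lemma weak_limit_potential_le:
  fixes A :: "'a::euclidean_space set"
  assumes A: "compact A" and K: "lsc_on (A \<times> A) (\<lambda>(x, y). K x y)"
    and M: "\<And>i. M i \<in> prob_measures_on A" and \<nu>: "\<nu> \<in> prob_measures_on A"
    and weak: "weakly_converges_on A M \<nu>"
    and \<mu>: "\<mu> \<in> prob_measures_on A" "measure_support \<mu> = A"
    and p: "\<And>i. p i \<le> W"
    and L1: "(\<lambda>i. \<integral>\<^sup>+x\<in>A. (potential A K (M i) x - p i) \<partial>\<mu>) \<longlonglongrightarrow> 0"
    and x: "x \<in> A"
  shows "potential A K \<nu> x \<le> W"
proof (rule ccontr)
  assume "\<not> ?thesis"
  then obtain c where c: "W < c" "c < potential A K \<nu> x" using dense by (auto simp: not_le)
  obtain V where V: "open V" "x \<in> V"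
    "\<forall>\<^sub>F i in sequentially. \<forall>x\<in>A \<inter> V. c < potential A K (M i) x"
    using potential_eventually_gt_nearby[OF A K M \<nu> weak x c(2)] by metis
  note \<mu>' = prob_measures_onD[OF compact_imp_closed[OF A] \<mu>(1)]
  have meas: "A \<inter> V \<in> sets \<mu>" using A V(1) by (simp add: \<mu>'(1) compact_imp_closed)
  have "emeasure \<mu> (A \<inter> V) = emeasure \<mu> V"
    using \<mu>'(3) meas V(1) by (intro emeasure_eq_AE) (auto simp: \<mu>'(1))
  also have "\<dots> > 0" using \<mu>(2) x V(1,2) by (auto simp: measure_support_def)
  finally have pos: "0 < (c - W) * emeasure \<mu> (A \<inter> V)"
    using c(1) by (simp add: ennreal_zero_less_mult_iff diff_gr0_ennreal)
  from order_tendstoD(2)[OF L1 this] V(3)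
  have "\<forall>\<^sub>F i in sequentially. False"
  proof eventually_elim
    case (elim i)
    \<comment> \<open>Markov-type bound: on \<open>A \<inter> V\<close> the potential exceeds
      \<open>c\<close> while \<open>p i \<le> W\<close>, so the integrals cannot drop below a fixed
      positive number.\<close>
    have "(c - W) * emeasure \<mu> (A \<inter> V) = (\<integral>\<^sup>+x\<in>A \<inter> V. (c - W) \<partial>\<mu>)"
      using meas by (simp add: nn_integral_cmult_indicator)
    also have "\<dots> \<le> (\<integral>\<^sup>+x\<in>A. (potential A K (M i) x - p i) \<partial>\<mu>)"
      using elim(2) p[of i]
      by (intro nn_integral_mono)
        (auto split: split_indicator intro!: ennreal_minus_mono intro: less_imp_le)
    finally show ?case using elim(1) by simp
  qed
  then show False by simp
qed

section \<open>Weak sequential compactness\<close>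

text \<open>At the first differing digit \<open>j\<close> the sums move apart by
  \<open>1 / 3 ^ j\<close>, and all later digits together make up at most half of that. Base 3 with
  digits 0 and 1 leaves this gap; in base 2 the tail could cancel the difference completely.\<close>

lemma sum_ternary_eq_imp_digits_eq:
  fixes a b :: "nat \<Rightarrow> real"
  assumes a: "\<And>i. a i \<in> {0, 1}" and b: "\<And>i. b i \<in> {0, 1}"
    and close: "\<bar>(\<Sum>i. a i / 3 ^ i) - (\<Sum>i. b i / 3 ^ i)\<bar> < 1 / (2 * 3 ^ m)" and "k \<le> m"
  shows "a k = b k"
proof (rule ccontr)
  assume "a k \<noteq> b k"
  define j where "j = (LEAST j. a j \<noteq> b j)"
  have j: "a j \<noteq> b j" and "j \<le> k"
    unfolding j_def by (rule LeastI Least_le, fact)+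
  have least: "a i = b i" if "i < j" for i
    using not_less_Least[OF that[unfolded j_def]] by blast
  have geo: "summable (\<lambda>i. 1 / 3 ^ i :: real)"
    using summable_geometric[of "1 / 3 :: real"] by (simp add: power_divide)
  have summ: "summable (\<lambda>i. c i / 3 ^ i)" if "\<And>i. \<bar>c i\<bar> \<le> 1" for c :: "nat \<Rightarrow> real"
    by (rule summable_comparison_test'[OF geo]) (use that in \<open>simp add: divide_right_mono\<close>)
  define d where "d i = a i - b i" for i
  have d1: "\<bar>d i\<bar> \<le> 1" for i using a[of i] b[of i] by (auto simp: d_def)
  have dj: "\<bar>d j\<bar> = 1" using a[of j] b[of j] j by (auto simp: d_def)
  have "(\<Sum>i. a i / 3 ^ i) - (\<Sum>i. b i / 3 ^ i) = (\<Sum>i. d i / 3 ^ i)"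
    unfolding d_def diff_divide_distrib
    by (intro suminf_diff summ) (metis a abs_0 abs_1 empty_iff insert_iff order_refl zero_le_one,
        metis b abs_0 abs_1 empty_iff insert_iff order_refl zero_le_one)
  also have "\<dots> = (\<Sum>i. d (i + Suc j) / 3 ^ (i + Suc j)) + (\<Sum>i<Suc j. d i / 3 ^ i)"
    by (rule suminf_split_initial_segment) (rule summ[OF d1])
  also have "(\<Sum>i<Suc j. d i / 3 ^ i) = d j / 3 ^ j"
    by (simp add: least d_def)
  finally have split: "(\<Sum>i. a i / 3 ^ i) - (\<Sum>i. b i / 3 ^ i) =
    (\<Sum>i. d (i + Suc j) / 3 ^ (i + Suc j)) + d j / 3 ^ j" .
  have tail: "(\<lambda>i. 1 / 3 ^ (i + Suc j)) sums (1 / (2 * 3 ^ j) :: real)"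
    using sums_mult[OF geometric_sums[of "1 / 3 :: real"], of "1 / 3 ^ Suc j"]
    by (simp add: power_add power_divide field_simps)
  have "\<bar>\<Sum>i. d (i + Suc j) / 3 ^ (i + Suc j)\<bar> \<le> (\<Sum>i. 1 / 3 ^ (i + Suc j))"
    using norm_suminf_le[OF _ sums_summable[OF tail], of "\<lambda>i. d (i + Suc j) / 3 ^ (i + Suc j)"] d1
    by (simp add: divide_right_mono)
  also have "\<dots> = 1 / (2 * 3 ^ j)" using tail by (rule sums_unique[symmetric])
  finally have "1 / (2 * 3 ^ j) \<le> \<bar>(\<Sum>i. a i / 3 ^ i) - (\<Sum>i. b i / 3 ^ i)\<bar>"
    unfolding split
  proof -
    have "\<bar>d j / 3 ^ j\<bar> = 1 / 3 ^ j" using dj by (simp add: abs_divide)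
    moreover have "(1 / 3 ^ j :: real) = 1 / (2 * 3 ^ j) + 1 / (2 * 3 ^ j)" by simp
    moreover assume "\<bar>\<Sum>i. d (i + Suc j) / 3 ^ (i + Suc j)\<bar> \<le> 1 / (2 * 3 ^ j)"
    ultimately show "1 / (2 * 3 ^ j) \<le> \<bar>(\<Sum>i. d (i + Suc j) / 3 ^ (i + Suc j)) + d j / 3 ^ j\<bar>"
      by linarith
  qed
  moreover have "1 / (2 * 3 ^ m) \<le> (1 / (2 * 3 ^ j) :: real)"
    using \<open>j \<le> k\<close> \<open>k \<le> m\<close> by (intro divide_left_mono mult_left_mono power_increasing) auto
  ultimately show False using close by linarith
qed

text \<open>The ternary digits of \<open>\<psi> x\<close> record in which of countably many small balls \<open>x\<close> lies, so
  that on \<open>A\<close> the Borel function \<open>\<psi>\<close> has a uniformly continuous inverse.\<close>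

lemma compact_encode_real:
  fixes A :: "'a::metric_space set"
  assumes "compact A"
  obtains \<psi> :: "'a \<Rightarrow> real" where "\<psi> \<in> borel_measurable borel" "\<And>x. \<psi> x \<in> {0..2}"
    "\<And>e. e > 0 \<Longrightarrow> \<exists>d>0. \<forall>x\<in>A. \<forall>y\<in>A. \<bar>\<psi> x - \<psi> y\<bar> < d \<longrightarrow> dist x y < e"
proof -
  have "\<exists>T. finite T \<and> A \<subseteq> (\<Union>x\<in>T. ball x (1 / real (Suc n)))" for n
    using assms unfolding compact_eq_totally_bounded by simp
  then obtain T where T: "\<And>n. finite (T n)" "\<And>n. A \<subseteq> (\<Union>x\<in>T n. ball x (1 / real (Suc n)))"
    by metis
  define I where "I = (SIGMA n:UNIV. T n)"
  have I: "countable I" using T(1) by (auto simp: I_def intro: countable_finite)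
  \<comment> \<open>Only surjectivity of the enumeration onto \<open>I\<close> is used below, so
    repeated balls are harmless.\<close>
  define B where "B i = (case from_nat_into I i of (n, x) \<Rightarrow> ball x (1 / real (Suc n)))" for i
  have open_B: "open (B i)" for i by (auto simp: B_def split: prod.split)
  define \<psi> where "\<psi> x = (\<Sum>i. indicat_real (B i) x / 3 ^ i)" for x
  have geo: "(\<lambda>i. 1 / 3 ^ i) sums (3 / 2 :: real)"
    using geometric_sums[of "1 / 3 :: real"] by (simp add: power_divide)
  have summ: "summable (\<lambda>i. indicat_real (B i) x / 3 ^ i)" for x
    by (rule summable_comparison_test'[OF sums_summable[OF geo]]) (simp split: split_indicator)
  show ?thesis
  proof (rule that)
    show "\<psi> \<in> borel_measurable borel"
      unfolding \<psi>_def using open_B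
      by (intro borel_measurable_suminf borel_measurable_divide borel_measurable_indicator) auto
    show "\<psi> x \<in> {0..2}" for x
    proof -
      have "\<psi> x \<le> (\<Sum>i. 1 / 3 ^ i)" unfolding \<psi>_def
        by (intro suminf_le summ sums_summable[OF geo]) (simp split: split_indicator)
      also have "\<dots> \<le> 2" using sums_unique[OF geo] by simp
      finally show ?thesis by (auto simp: \<psi>_def intro!: suminf_nonneg summ)
    qed
    fix e :: real assume "e > 0"
    then obtain n where n: "1 / real (Suc n) < e / 2"
      using nat_approx_posE[of "e / 2"] by auto
    have "\<exists>i. from_nat_into I i = (n, x)" if "x \<in> T n" for x
      using that by (intro from_nat_into_surj I) (auto simp: I_def)
    then obtain j where j: "\<And>x. x \<in> T n \<Longrightarrow> from_nat_into I (j x) = (n, x)" by metis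
    \<comment> \<open>The last position that holds the digit of a level-\<open>n\<close> ball:
      agreement up to \<open>m\<close> settles membership in all balls of that level.\<close>
    define m where "m = Max (j ` T n)"
    have "dist x y < e" if xy: "x \<in> A" "y \<in> A" "\<bar>\<psi> x - \<psi> y\<bar> < 1 / (2 * 3 ^ m)" for x y
    proof -
      obtain t where t: "t \<in> T n" "x \<in> ball t (1 / real (Suc n))" using T(2)[of n] xy(1) by auto
      have Bt: "B (j t) = ball t (1 / real (Suc n))" by (simp add: B_def j t(1))
      have "indicat_real (B (j t)) x = indicat_real (B (j t)) y"
        using xy(3) unfolding \<psi>_def
        by (rule sum_ternary_eq_imp_digits_eq[rotated 2])
          (use T(1) t(1) in \<open>auto simp: m_def indicator_def\<close>)
      with t(2) have "y \<in> ball t (1 / real (Suc n))"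
        unfolding Bt by (auto simp: indicator_def split: if_splits)
      with t(2) have "dist t x < e / 2" "dist t y < e / 2" using n by auto
      then show ?thesis by (metis dist_commute dist_triangle_half_l)
    qed
    then show "\<exists>d>0. \<forall>x\<in>A. \<forall>y\<in>A. \<bar>\<psi> x - \<psi> y\<bar> < d \<longrightarrow> dist x y < e"
      by (intro exI[of _ "1 / (2 * 3 ^ m)"]) auto
  qed
qed

text \<open>A measure carried by \<open>A\<close> does not see values off \<open>A\<close>. A
  function given on \<open>A\<close> can thus be replaced by a global extension, to which the change
  of variables formula applies.\<close>

lemma set_integral_eq_integral_extension:
  fixes g G :: "'a::euclidean_space \<Rightarrow> real"
  assumes A: "closed A" and M: "M \<in> prob_measures_on A" and G: "G \<in> borel_measurable borel"
    and eq: "\<And>x. x \<in> A \<Longrightarrow> G x = g x"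
  shows "(LINT x:A|M. g x) = (LINT x|M. G x)"
proof -
  note M' = prob_measures_onD[OF A M]
  have G' [measurable]: "G \<in> borel_measurable M" and A' [measurable]: "A \<in> sets M"
    using G A by (simp_all add: measurable_cong_sets[OF M'(1) refl] M'(1))
  have "(LINT x:A|M. g x) = (LINT x|M. indicat_real A x *\<^sub>R G x)"
    unfolding set_lebesgue_integral_def using eq
    by (intro Bochner_Integration.integral_cong) (auto split: split_indicator)
  also have "\<dots> = (LINT x|M. G x)"
    using M'(3) by (intro integral_cong_AE) auto
  finally show ?thesis .
qed

text \<open>Push the measures to the line along \<open>\<psi>\<close>, extract a weak limit there,
  and push it back along a continuous \<open>\<Phi>\<close> that inverts \<open>\<psi>\<close> on
  \<open>A\<close>. It does no harm that \<open>\<psi>\<close> is merely Borel: a test function on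
  \<open>A\<close>, extended to \<open>G\<close>, becomes \<open>G\<close> after
  \<open>\<Phi>\<close> on the line, which is bounded and continuous.\<close>

theorem prob_measures_on_seq_compact:
  fixes A :: "'a::euclidean_space set"
  assumes A: "compact A" and M: "\<And>i. M i \<in> prob_measures_on A"
  obtains r :: "nat \<Rightarrow> nat" and \<nu>
  where "strict_mono r" "\<nu> \<in> prob_measures_on A" "weakly_converges_on A (M \<circ> r) \<nu>"
proof -
  have cl: "closed A" using A by (rule compact_imp_closed)
  note M' = prob_measures_onD[OF cl M]
  note [measurable_cong] = M'(1)
  have space_M: "space (M i) = UNIV" for i using sets_eq_imp_space_eq[OF M'(1)[of i]] by simp
  have "A \<noteq> {}" using M'(4)[of 0] by auto
  obtain \<psi> :: "'a \<Rightarrow> real" where \<psi>[measurable]: "\<psi> \<in> borel_measurable borel"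
    and \<psi>_range: "\<And>x. \<psi> x \<in> {0..2}"
    and \<psi>_sep: "\<And>e. e > 0 \<Longrightarrow> \<exists>d>0. \<forall>x\<in>A. \<forall>y\<in>A. \<bar>\<psi> x - \<psi> y\<bar> < d \<longrightarrow> dist x y < e"
    using compact_encode_real[OF A] by metis
  define C where "C = closure (\<psi> ` A)"
  have "inj_on \<psi> A"
  proof (rule inj_onI, rule ccontr)
    fix x y assume "x \<in> A" "y \<in> A" "\<psi> x = \<psi> y" "x \<noteq> y"
    with \<psi>_sep[of "dist x y"] show False by (metis abs_zero diff_self less_irrefl zero_less_dist_iff)
  qed
  then have inv: "inv_into A \<psi> (\<psi> x) = x" if "x \<in> A" for x using that by simp
  have "uniformly_continuous_on (\<psi> ` A) (inv_into A \<psi>)"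
    unfolding uniformly_continuous_on_def
  proof (intro allI impI)
    fix e :: real assume "e > 0"
    from \<psi>_sep[OF this] obtain d where "d > 0" "\<And>x y. x \<in> A \<Longrightarrow> y \<in> A \<Longrightarrow> \<bar>\<psi> x - \<psi> y\<bar> < d \<Longrightarrow> dist x y < e"
      by blast
    then show "\<exists>d>0. \<forall>s\<in>\<psi> ` A. \<forall>s'\<in>\<psi> ` A. dist s' s < d \<longrightarrow>
        dist (inv_into A \<psi> s') (inv_into A \<psi> s) < e"
      by (intro exI[of _ d]) (simp add: inv dist_real_def)
  qed
  \<comment> \<open>The image of \<open>A\<close> need not be closed. Uniform continuity extends the
    inverse to its closure \<open>C\<close>, from where Tietze takes it to the whole line.\<close>
  then obtain \<phi> where \<phi>: "uniformly_continuous_on C \<phi>" "\<And>s. s \<in> \<psi> ` A \<Longrightarrow> inv_into A \<psi> s = \<phi> s"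
    unfolding C_def using uniformly_continuous_on_extension_on_closure by metis
  have \<phi>_cont: "continuous_on C \<phi>" using \<phi>(1) by (rule uniformly_continuous_imp_continuous)
  obtain \<Phi> where \<Phi>: "continuous_on UNIV \<Phi>" "\<And>s. s \<in> C \<Longrightarrow> \<Phi> s = \<phi> s"
    using Tietze_unbounded[OF \<phi>_cont, of UNIV] by (auto simp: C_def)
  have \<psi>_C: "\<psi> x \<in> C" if "x \<in> A" for x using that closure_subset by (force simp: C_def)
  have \<Phi>_\<psi>: "\<Phi> (\<psi> x) = x" if "x \<in> A" for x
    using that \<phi>(2)[of "\<psi> x"] \<Phi>(2)[OF \<psi>_C[OF that]] inv by auto
  \<comment> \<open>Since \<open>A\<close> is closed, the points added by the closure are mapped
    into \<open>A\<close> as well; this will place the limit measure on \<open>A\<close>.\<close>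
  have "\<phi> ` closure (\<psi> ` A) \<subseteq> A"
    using \<phi>_cont cl \<phi>(2) inv by (intro image_closure_subset) (auto simp: C_def)
  then have \<Phi>_C: "\<Phi> s \<in> A" if "s \<in> C" for s using that \<Phi>(2) by (auto simp: C_def)
  have \<Phi>_meas[measurable]: "\<Phi> \<in> borel_measurable borel" using \<Phi>(1) by (rule borel_measurable_continuous_onI)

  \<comment> \<open>Helly selection for the image laws on the line\<close>
  define \<Lambda> where "\<Lambda> i = distr (M i) borel \<psi>" for i
  have dist_\<Lambda>: "real_distribution (\<Lambda> i)" for i
  proof -
    interpret prob_space "M i" by (rule M')
    show ?thesis unfolding \<Lambda>_def by (rule real_distribution_distr) simp
  qed
  \<comment> \<open>All image laws live on \<open>[0, 2]\<close>, which makes tightness immediate.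
    The interval is open on the left, so it has to start below 0.\<close>
  have "measure (\<Lambda> i) {-1<..2} = 1" for i
  proof -
    interpret prob_space "M i" by (rule M')
    have "\<psi> -` {-1<..2} \<inter> space (M i) = space (M i)" using \<psi>_range by force
    then show ?thesis unfolding \<Lambda>_def by (subst measure_distr) (auto simp: prob_space)
  qed
  then have "\<exists>a b::real. a < b \<and> (\<forall>n. measure (\<Lambda> n) {a<..b} > 1 - \<epsilon>)" if "\<epsilon> > 0" for \<epsilon>
    using that by (intro exI[of _ "-1"] exI[of _ 2]) simp
  with dist_\<Lambda> have "tight \<Lambda>" by (simp add: tight_def)
  from tight_imp_convergent_subsubsequence[OF this, of id]
  obtain r L where r: "strict_mono r" and L: "real_distribution L" and conv: "weak_conv_m (\<Lambda> \<circ> r) L"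
    by (auto simp: strict_mono_def)
  interpret L: real_distribution L by fact
  have lim: "(\<lambda>i. LINT x|M (r i). H (\<psi> x)) \<longlonglongrightarrow> (LINT s|L. H s)"
    if H: "continuous_on UNIV H" and B: "\<And>s. \<bar>H s\<bar> \<le> B" for H :: "real \<Rightarrow> real" and B
  proof -
    have [measurable]: "H \<in> borel_measurable borel" using H by (rule borel_measurable_continuous_onI)
    have "(\<lambda>i. LINT s|(\<Lambda> \<circ> r) i. H s) \<longlonglongrightarrow> (LINT s|L. H s)"
      using dist_\<Lambda> L conv
      by (intro weak_conv_imp_integral_bdd_continuous_conv[where B=B])
        (use H B dist_\<Lambda> L conv in \<open>auto simp: continuous_on_eq_continuous_at comp_def\<close>)
    then show ?thesis by (simp add: \<Lambda>_def integral_distr)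
  qed
  \<comment> \<open>The truncated distance to \<open>C\<close> is a bounded continuous test function
    with zero set \<open>C\<close>. Its integral vanishes along the sequence, hence in the
    limit.\<close>
  have "AE s in L. s \<in> C"
  proof -
    let ?H = "\<lambda>s. min 1 (infdist s C)"
    have H: "continuous_on UNIV ?H" by (intro continuous_intros)
    then have [measurable]: "?H \<in> borel_measurable borel" by (rule borel_measurable_continuous_onI)
    have "(LINT x|M (r i). ?H (\<psi> x)) = 0" for i
      by (rule integral_eq_zero_AE) (use M'(3)[of "r i"] \<psi>_C in \<open>auto elim!: eventually_mono\<close>)
    moreover have "(\<lambda>i. LINT x|M (r i). ?H (\<psi> x)) \<longlonglongrightarrow> (LINT s|L. ?H s)"
      by (rule lim[OF H, of 1]) (auto simp: infdist_nonneg)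
    ultimately have "(LINT s|L. ?H s) = 0" by (simp add: LIMSEQ_const_iff)
    moreover have "integrable L ?H"
      by (rule L.integrable_const_bound[where B=1]) (auto simp: infdist_nonneg)
    ultimately have "AE s in L. ?H s = 0"
      by (subst (asm) integral_nonneg_eq_0_iff_AE) (auto simp: infdist_nonneg)
    then show ?thesis
    proof eventually_elim
      case (elim s)
      then have "infdist s C = 0" by (auto simp: min_def split: if_splits)
      then show ?case
        using in_closed_iff_infdist_zero[of C s] \<open>A \<noteq> {}\<close> by (auto simp: C_def)
    qed
  qed
  then have "AE s in L. \<Phi> s \<in> A" using \<Phi>_C by (auto elim!: eventually_mono)
  define \<nu> where "\<nu> = distr L borel \<Phi>"
  have "AE x in \<nu>. x \<in> A"
    unfolding \<nu>_def using \<open>AE s in L. \<Phi> s \<in> A\<close> cl by (subst AE_distr_iff) auto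
  moreover have "sets \<nu> = sets borel" "prob_space \<nu>"
    by (auto simp: \<nu>_def intro!: L.prob_space_distr)
  ultimately have \<nu>: "\<nu> \<in> prob_measures_on A"
    by (simp add: prob_measures_on_iff[OF cl])
  have "weakly_converges_on A (M \<circ> r) \<nu>"
    unfolding weakly_converges_on_def
  proof (intro allI impI)
    fix g :: "'a \<Rightarrow> real" assume g: "continuous_on A g"
    obtain B where B: "B > 0" "\<And>x. x \<in> A \<Longrightarrow> norm (g x) \<le> B"
      using compact_imp_bounded[OF compact_continuous_image[OF g A]]
      by (auto simp: bounded_pos)
    obtain G where G: "continuous_on UNIV G" "\<And>x. x \<in> A \<Longrightarrow> G x = g x" "\<And>x. norm (G x) \<le> B"
      using Tietze[OF g, of UNIV B] cl B by auto
    have G_meas[measurable]: "G \<in> borel_measurable borel" using G(1) by (rule borel_measurable_continuous_onI)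
    have "(LINT x:A|M (r i). g x) = (LINT x|M (r i). G (\<Phi> (\<psi> x)))" for i
      using set_integral_eq_integral_extension[OF cl M G_meas G(2)] M'(3)[of "r i"] \<Phi>_\<psi>
      by (auto intro!: integral_cong_AE elim!: eventually_mono)
    moreover have "(\<lambda>i. LINT x|M (r i). G (\<Phi> (\<psi> x))) \<longlonglongrightarrow> (LINT s|L. G (\<Phi> s))"
      using lim[of "\<lambda>s. G (\<Phi> s)" B] G(3) continuous_on_compose2[OF G(1) \<Phi>(1)] by auto
    moreover have "(LINT s|L. G (\<Phi> s)) = (LINT x:A|\<nu>. g x)"
      using set_integral_eq_integral_extension[OF cl \<nu> G_meas G(2)]
      by (simp add: \<nu>_def integral_distr)
    ultimately show "(\<lambda>N. LINT x:A|(M \<circ> r) N. g x) \<longlonglongrightarrow> (LINT x:A|\<nu>. g x)" by simp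
  qed
  with r \<nu> show ?thesis by (rule that)
qed

section \<open>Polarization and equilibrium\<close>

lemma empirical_measure_in_prob_measures_on:
  assumes "closed A" "N \<ge> 1" "a \<in> {1..N} \<rightarrow> A"
  shows "empirical_measure N a \<in> prob_measures_on A"
proof -
  interpret prob_space "uniform_count_measure {1..N}"
    using assms(2) by (intro prob_space_uniform_count_measure) auto
  have a: "a \<in> uniform_count_measure {1..N} \<rightarrow>\<^sub>M borel"
    by (simp add: uniform_count_measure_def)
  have "AE x in empirical_measure N a. x \<in> A"
    unfolding empirical_measure_def using assms(1,3)
    by (subst AE_distr_iff[OF a]) (auto simp: space_uniform_count_measure intro!: AE_I2)
  moreover have "prob_space (empirical_measure N a)"
    unfolding empirical_measure_def using a by (rule prob_space_distr)
  ultimately show ?thesis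
    by (simp add: prob_measures_on_iff[OF assms(1)]) (simp add: empirical_measure_def)
qed

text \<open>Lets the results on potentials of measures apply to averages over
  configurations.\<close>

lemma potential_empirical_measure:
  assumes K: "(\<lambda>y. K x y * indicator A y) \<in> borel_measurable borel"
    and "N \<ge> 1" and a: "a \<in> {1..N} \<rightarrow> A"
  shows "potential A K (empirical_measure N a) x = mean_potential K N a x"
proof -
  have "a \<in> uniform_count_measure {1..N} \<rightarrow>\<^sub>M borel"
    by (simp add: uniform_count_measure_def)
  then have "potential A K (empirical_measure N a) x =
      (\<integral>\<^sup>+j. K x (a j) * indicator A (a j) \<partial>uniform_count_measure {1..N})"
    unfolding potential_def empirical_measure_def using K by (simp add: nn_integral_distr)
  also have "\<dots> = (\<Sum>j=1..N. ennreal (1 / real N) * (K x (a j) * indicator A (a j)))"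
    by (simp add: uniform_count_measure_def nn_integral_point_measure_finite)
  also have "\<dots> = (\<Sum>j=1..N. ennreal (1 / real N) * K x (a j))"
    using a by (intro sum.cong) (auto simp: Pi_iff)
  also have "ennreal (1 / real N) = 1 / of_nat N"
    using \<open>N \<ge> 1\<close> by (simp add: divide_ennreal[symmetric] ennreal_of_nat_eq_real_of_nat)
  finally show ?thesis by (simp add: mean_potential_def sum_distrib_left)
qed

text \<open>The \<open>ennreal\<close> subtraction in the last clause is genuine for
  \<open>N \<ge> 2\<close>: there \<open>P N\<close> is finite and bounds the mean potential from
  below on \<open>A\<close>. The finitely many terms with \<open>N < 2\<close> do not affect the
  limits.\<close>

theorem theorem1p1:
  fixes A :: "(real ^ 't) set"
    and f :: "real \<Rightarrow> ennreal"
    and K :: "real ^ 't \<Rightarrow> real ^ 't \<Rightarrow> ennreal"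
    and \<mu>eq :: "(real ^ 't) measure"
    and W :: ennreal
    and \<omega> :: "nat \<Rightarrow> nat \<Rightarrow> real ^ 't"
  assumes A: "compact A"
    and f: "lsc_on {0..} f"
    and K: "\<And>x y. x \<in> A \<Longrightarrow> y \<in> A \<Longrightarrow> K x y = f (norm (x - y))"
    and A1: "\<exists>\<mu>\<in>prob_measures_on A. energy A K \<mu> < \<infinity>"
    and A2: "\<exists>!\<mu>. equilibrium_measure A K \<mu>" "equilibrium_measure A K \<mu>eq"
    and A3: "measure_support \<mu>eq = A"
    and A4: "W > 0" "\<And>x. x \<in> A \<Longrightarrow> potential A K \<mu>eq x = W"
    and \<omega>: "\<And>N. N \<ge> 2 \<Longrightarrow> \<omega> N \<in> {1..N} \<rightarrow>\<^sub>E A"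
  defines "\<nu> \<equiv> (\<lambda>N. empirical_measure N (\<omega> N))"
    and "P \<equiv> (\<lambda>N. polarization A K N (\<omega> N))"
  shows "(weakly_converges_on A \<nu> \<mu>eq \<longleftrightarrow> P \<longlonglongrightarrow> W) \<and>
         (P \<longlonglongrightarrow> W \<longleftrightarrow>
           (\<lambda>N. \<integral>\<^sup>+x\<in>A. (mean_potential K N (\<omega> N) x - P N) \<partial>\<mu>eq) \<longlonglongrightarrow> 0)"
proof -

  \<comment> \<open>Regularity and symmetry of the kernel, and the energy of
    \<open>\<mu>eq\<close>\<close>
  have cl: "closed A" using A by (rule compact_imp_closed)
  have \<mu>: "\<mu>eq \<in> prob_measures_on A" and \<mu>_min: "energy A K \<mu>eq = (INF \<mu>\<in>prob_measures_on A. energy A K \<mu>)"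
    using A2(2) by (auto simp: equilibrium_measure_def)
  note \<mu>' = prob_measures_onD[OF cl \<mu>]
  have A_sets[measurable]: "A \<in> sets borel" "A \<in> sets \<mu>eq" using cl \<mu>' by auto
  have "A \<noteq> {}" using \<mu>'(4) by auto
  have sym: "K x y = K y x" if "x \<in> A" "y \<in> A" for x y
    using that by (simp add: K norm_minus_commute)
  have "lsc_on (A \<times> A) (\<lambda>p. f (norm (fst p - snd p)))"
    by (intro lsc_on_compose[OF f] continuous_intros) auto
  then have lsc: "lsc_on (A \<times> A) (\<lambda>(x, y). K x y)"
    by (rule lsc_on_cong) (auto simp: K)
  have meas: "(\<lambda>y. K x y * indicator A y) \<in> borel_measurable borel" if "x \<in> A" for x
    using lsc_kernel_section[OF lsc that] A_sets(1) by (rule lsc_on_borel_measurable)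
  have meas': "(\<lambda>x. K x y * indicator A x) \<in> borel_measurable borel" if "y \<in> A" for y
  proof -
    have "(\<lambda>x. K x y * indicator A x) = (\<lambda>x. K y x * indicator A x)"
      using sym[OF that] by (auto split: split_indicator)
    then show ?thesis using meas[OF that] by simp
  qed
  have potential_sym: "(\<integral>\<^sup>+x\<in>A. K x y \<partial>M) = potential A K M y" if "y \<in> A" for y M
    unfolding potential_def using sym that by (intro nn_integral_cong) (simp split: split_indicator)
  have energy_eq: "energy A K M = (\<integral>\<^sup>+y\<in>A. potential A K M y \<partial>M)" for M
    unfolding energy_def using potential_sym by (intro nn_integral_cong) (simp split: split_indicator)
  have const: "(\<integral>\<^sup>+y\<in>A. c \<partial>M) = c" if "M \<in> prob_measures_on A" for c M
    using prob_measures_onD[OF cl that] cl by (simp add: nn_integral_cmult_indicator)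
  have "energy A K \<mu>eq = (\<integral>\<^sup>+y\<in>A. W \<partial>\<mu>eq)"
    unfolding energy_eq using A4(2) by (intro nn_integral_cong) (simp split: split_indicator)
  then have energy_\<mu>: "energy A K \<mu>eq = W" by (simp add: const[OF \<mu>])
  \<comment> \<open>\<open>W\<close> is the minimal energy, so (A1) makes it finite; the
    \<open>ennreal\<close> subtractions below rely on this.\<close>
  have W_fin: "W < \<infinity>"
    using A1 \<mu>_min energy_\<mu> by (metis INF_lower le_less_trans)

  \<comment> \<open>Mean potentials integrated against \<open>\<mu>eq\<close>: equivalence of (2)
    and (3)\<close>
  let ?m = "\<lambda>N x. mean_potential K N (\<omega> N) x"
  have \<omega>A: "\<omega> N j \<in> A" if "N \<ge> 2" "j \<in> {1..N}" for N j using \<omega>[OF that(1)] that(2) by auto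
  have m_meas: "(\<lambda>x. ?m N x * indicator A x) \<in> borel_measurable \<mu>eq" if "N \<ge> 2" for N
  proof -
    have "(\<lambda>x. 1 / of_nat N * (\<Sum>j=1..N. K x (\<omega> N j) * indicator A x)) \<in> borel_measurable borel"
      by (rule borel_measurable_times_ennreal[OF borel_measurable_const borel_measurable_sum[OF meas'[OF \<omega>A[OF that]]]])
    then show ?thesis
      unfolding mean_potential_def measurable_cong_sets[OF \<mu>'(1) refl]
      by (simp add: sum_distrib_right mult.assoc)
  qed
  have m_int: "(\<integral>\<^sup>+x\<in>A. ?m N x \<partial>\<mu>eq) = W" if N: "N \<ge> 2" for N
  proof -
    have K_meas: "(\<lambda>x. K x (\<omega> N j) * indicator A x) \<in> borel_measurable \<mu>eq" if "j \<in> {1..N}" for j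
      using meas'[OF \<omega>A[OF N that]] by (simp add: measurable_cong_sets[OF \<mu>'(1) refl])
    have "(\<integral>\<^sup>+x\<in>A. ?m N x \<partial>\<mu>eq) = (\<integral>\<^sup>+x. 1 / of_nat N * (\<Sum>j=1..N. K x (\<omega> N j) * indicator A x) \<partial>\<mu>eq)"
      by (simp add: mean_potential_def sum_distrib_right mult.assoc)
    also have "\<dots> = 1 / of_nat N * (\<Sum>j=1..N. \<integral>\<^sup>+x\<in>A. K x (\<omega> N j) \<partial>\<mu>eq)"
      by (subst nn_integral_cmult[OF borel_measurable_sum[OF K_meas]])
        (simp_all only: nn_integral_sum[OF K_meas])
    also have "\<dots> = 1 / of_nat N * (\<Sum>j=1..N. W)"
      using A4(2) potential_sym \<omega>A[OF N] by (intro arg_cong2[where f="(*)"] sum.cong) auto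
    also have "\<dots> = W"
      using N mult_divide_eq_ennreal[of "of_nat N" W]
      by (simp add: ennreal_divide_times ennreal_times_divide mult.commute)
    finally show ?thesis .
  qed
  have P_lower: "P N \<le> ?m N x" if "x \<in> A" for N x
    unfolding P_def polarization_def using that by (rule INF_lower)
  have P_le: "P N \<le> W" if "N \<ge> 2" for N
  proof -
    have "(\<integral>\<^sup>+x\<in>A. P N \<partial>\<mu>eq) \<le> (\<integral>\<^sup>+x\<in>A. ?m N x \<partial>\<mu>eq)"
      using P_lower by (intro nn_integral_mono) (simp split: split_indicator)
    then show ?thesis by (simp add: const[OF \<mu>] m_int[OF that])
  qed
  have L1_eq: "(\<integral>\<^sup>+x\<in>A. (?m N x - P N) \<partial>\<mu>eq) = W - P N" if N: "N \<ge> 2" for N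
  proof -
    have "(\<integral>\<^sup>+x\<in>A. (?m N x - P N) \<partial>\<mu>eq) = (\<integral>\<^sup>+x. ?m N x * indicator A x - P N * indicator A x \<partial>\<mu>eq)"
      by (intro nn_integral_cong) (simp split: split_indicator)
    \<comment> \<open>Splitting the integral requires the subtracted one to be finite; it equals
      \<open>P N\<close>, which is at most \<open>W\<close>.\<close>
    also have "\<dots> = (\<integral>\<^sup>+x\<in>A. ?m N x \<partial>\<mu>eq) - (\<integral>\<^sup>+x\<in>A. P N \<partial>\<mu>eq)"
      using P_lower P_le[OF N] W_fin
      by (intro nn_integral_diff m_meas[OF N] AE_I2)
        (auto simp: const[OF \<mu>] split: split_indicator)
    finally show ?thesis by (simp add: const[OF \<mu>] m_int[OF N])
  qed
  have iff_L1: "P \<longlonglongrightarrow> W \<longleftrightarrow> (\<lambda>N. \<integral>\<^sup>+x\<in>A. (?m N x - P N) \<partial>\<mu>eq) \<longlonglongrightarrow> 0"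
  proof -
    have ev: "\<forall>\<^sub>F N in sequentially. N \<ge> 2" by (rule eventually_ge_at_top)
    have "(\<lambda>N. \<integral>\<^sup>+x\<in>A. (?m N x - P N) \<partial>\<mu>eq) \<longlonglongrightarrow> 0 \<longleftrightarrow> (\<lambda>N. W - P N) \<longlonglongrightarrow> 0"
      by (rule tendsto_cong) (use ev in eventually_elim, rule L1_eq)
    moreover have "(\<lambda>N. W - P N) \<longlonglongrightarrow> 0" if "P \<longlonglongrightarrow> W"
      using tendsto_diff_ennreal_general[OF tendsto_const that, of W] W_fin by simp
    \<comment> \<open>\<open>P N\<close> is recovered as \<open>W - (W - P N)\<close>, which is
      valid because \<open>P N \<le> W\<close> and \<open>W\<close> is finite.\<close>
    moreover have "P \<longlonglongrightarrow> W" if "(\<lambda>N. W - P N) \<longlonglongrightarrow> 0"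
    proof (rule Lim_transform_eventually)
      show "(\<lambda>N. W - (W - P N)) \<longlonglongrightarrow> W"
        using tendsto_diff_ennreal_general[OF tendsto_const that, of W] by simp
      show "\<forall>\<^sub>F N in sequentially. W - (W - P N) = P N"
        using ev by eventually_elim (use P_le W_fin in \<open>simp add: diff_diff_ennreal less_top\<close>)
    qed
    ultimately show ?thesis by blast
  qed

  \<comment> \<open>Equivalence of (1) and (2)\<close>
  define M where "M i = \<nu> (i + 2)" for i
  \<comment> \<open>The shift by 2 turns every term into a probability measure on \<open>A\<close>,
    as the lemmas on potentials and compactness demand.\<close>
  have M: "M i \<in> prob_measures_on A" for i
    using \<omega>[of "i + 2"] unfolding M_def \<nu>_def
    by (intro empirical_measure_in_prob_measures_on cl) auto
  have pot_M: "potential A K (M i) x = ?m (i + 2) x" if "x \<in> A" for i x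
    using \<omega>[of "i + 2"] unfolding M_def \<nu>_def
    by (intro potential_empirical_measure meas that) auto
  have weak_shift: "weakly_converges_on A \<nu> \<mu>eq \<longleftrightarrow> weakly_converges_on A M \<mu>eq"
    unfolding weakly_converges_on_def M_def
    by (blast intro: LIMSEQ_offset dest: LIMSEQ_ignore_initial_segment)

  have polarization_lim: "P \<longlonglongrightarrow> W" if "weakly_converges_on A \<nu> \<mu>eq"
  proof (rule order_tendstoI)
    fix c assume "c < W"
    then have "\<forall>\<^sub>F i in sequentially. \<forall>x\<in>A. c < potential A K (M i) x"
      using that weak_shift A4(2) by (intro potential_eventually_gt[OF A lsc M \<mu>]) auto
    then have "\<forall>\<^sub>F i in sequentially. c < P (i + 2)"
    proof eventually_elim
      case (elim i)
      \<comment> \<open>Attainment of the minimum keeps the inequality strict; a bare infimum would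
        give only \<open>c \<le> P (i + 2)\<close>.\<close>
      obtain x where "x \<in> A" "?m (i + 2) x = P (i + 2)"
        using polarization_attained[OF A \<open>A \<noteq> {}\<close> f K \<omega>[of "i + 2"]] by (auto simp: P_def)
      with elim show ?case using pot_M by metis
    qed
    then show "\<forall>\<^sub>F N in sequentially. c < P N"
      by (rule eventually_sequentially_seg[THEN iffD1])
  next
    fix c assume "W < c"
    then show "\<forall>\<^sub>F N in sequentially. P N < c"
      using P_le by (intro eventually_sequentiallyI[of 2]) (blast intro: le_less_trans)
  qed

  have weak_lim: "weakly_converges_on A \<nu> \<mu>eq" if P_lim: "P \<longlonglongrightarrow> W"
  proof -
    have limit_unique: "\<nu>' = \<mu>eq"
      if t: "strict_mono t" and \<nu>': "\<nu>' \<in> prob_measures_on A" and weak: "weakly_converges_on A (M \<circ> t) \<nu>'"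
      for t \<nu>'
    proof -
      have "strict_mono (\<lambda>i. t i + 2)" using t by (simp add: strict_mono_def)
      then have "(\<lambda>i. \<integral>\<^sup>+x\<in>A. (?m (t i + 2) x - P (t i + 2)) \<partial>\<mu>eq) \<longlonglongrightarrow> 0"
        using LIMSEQ_subseq_LIMSEQ[OF iff_L1[THEN iffD1, OF P_lim]] by (simp add: comp_def)
      also have "(\<lambda>i. \<integral>\<^sup>+x\<in>A. (?m (t i + 2) x - P (t i + 2)) \<partial>\<mu>eq) =
          (\<lambda>i. \<integral>\<^sup>+x\<in>A. (potential A K ((M \<circ> t) i) x - P (t i + 2)) \<partial>\<mu>eq)"
        by (intro ext nn_integral_cong) (simp add: pot_M split: split_indicator)
      finally have "potential A K \<nu>' x \<le> W" if "x \<in> A" for x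
        using that P_le
        by (intro weak_limit_potential_le[OF A lsc _ \<nu>' weak \<mu> A3, where p="\<lambda>i. P (t i + 2)"])
          (auto simp: M)
      then have "energy A K \<nu>' \<le> (\<integral>\<^sup>+y\<in>A. W \<partial>\<nu>')"
        unfolding energy_eq by (intro nn_integral_mono) (simp split: split_indicator)
      then have "energy A K \<nu>' \<le> energy A K \<mu>eq" by (simp add: const[OF \<nu>'] energy_\<mu>)
      moreover have "energy A K \<mu>eq \<le> energy A K \<nu>'" unfolding \<mu>_min using \<nu>' by (rule INF_lower)
      ultimately have "equilibrium_measure A K \<nu>'"
        using \<nu>' \<mu>_min by (simp add: equilibrium_measure_def)
      with A2 show ?thesis by blast
    qed
    have "weakly_converges_on A M \<mu>eq"
      unfolding weakly_converges_on_def
    proof (intro allI impI, rule ccontr)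
      fix g :: "real ^ 't \<Rightarrow> real" assume g: "continuous_on A g"
      let ?I = "\<lambda>i. LINT x:A|M i. g x"
      assume "\<not> ?I \<longlonglongrightarrow> (LINT x:A|\<mu>eq. g x)"
      \<comment> \<open>If convergence fails for one test function, some subsequence
        \<open>s\<close> stays at distance at least \<open>e\<close> from the expected value. By
        compactness it has a weakly convergent subsequence, whose limit \<open>limit_unique\<close>
        identifies as \<open>\<mu>eq\<close>: a contradiction.\<close>
      then obtain e where e: "e > 0" "\<exists>\<^sub>F i in sequentially. \<not> dist (?I i) (LINT x:A|\<mu>eq. g x) < e"
        by (auto simp: tendsto_iff not_eventually)
      then have "infinite {i. \<not> dist (?I i) (LINT x:A|\<mu>eq. g x) < e}"
        by (simp add: INFM_iff_infinite cofinite_eq_sequentially[symmetric])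
      from infinite_enumerate[OF this] obtain s :: "nat \<Rightarrow> nat"
        where s: "strict_mono s" "\<And>i. \<not> dist (?I (s i)) (LINT x:A|\<mu>eq. g x) < e"
        by blast
      obtain r \<nu>' where r: "strict_mono r" "\<nu>' \<in> prob_measures_on A" "weakly_converges_on A (M \<circ> s \<circ> r) \<nu>'"
        using prob_measures_on_seq_compact[OF A, of "M \<circ> s"] M by auto
      then have "weakly_converges_on A (M \<circ> (s \<circ> r)) \<mu>eq"
        using limit_unique[of "s \<circ> r" \<nu>'] strict_mono_o[OF s(1) r(1)] by (simp add: comp_assoc)
      then have "(\<lambda>i. ?I (s (r i))) \<longlonglongrightarrow> (LINT x:A|\<mu>eq. g x)"
        using g by (simp add: weakly_converges_on_def)
      from tendstoD[OF this e(1)] s(2) show False by simp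
    qed
    then show ?thesis using weak_shift by simp
  qed
  show ?thesis using polarization_lim weak_lim iff_L1 by blast
qed

end
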